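(* Let $G$ be a finite group with subgroups $K_{\{0\}},K_{\{1\}}$ such that $\langle K_{\{0\}},K_{\{1\}}\rangle=G$. Then for every $\varepsilon\ge0$, $\|M_0|_{\ell_2^0(V_0)}\|\le\varepsilon$ if and only if $K_{\{0\}}$ and $K_{\{1\}}$ are $\varepsilon$-orthogonal.
   Context: Consider the bipartite graph $X(G,(K_{\{0\}},K_{\{1\}}))$ with sides $V_i=\{gK_{\{i\}}: g\in G\}$, $i=0,1$, where $gK_{\{0\}}$ and $g'K_{\{1\}}$ are adjacent iff they intersect; every vertex of $V_i$ has the same degree $d_i$. $\ell_2(V_i)$ is the space of functions $V_i\to\mathbb{C}$ with inner product $d_i\sum_{v\in V_i}\phi(v)\overline{\psi(v)}$, $\ell_2^0(V_i)$ the functions summing to $0$, and $M_0:\ell_2(V_0)\to\ell_2(V_1)$ is $(M_0\phi)(v)=\frac{1}{d_1}\sum_{u\in V_0, u\sim v}\phi(u)$; $\|\cdot\|$ is the operator norm. For closed subspaces $\mathcal{H}_1,\mathcal{H}_2$ of a Hilbert space, $\theta(\mathcal{H}_1,\mathcal{H}_2)$ is the infimum of $\kappa$ with $|\langle x_1,x_2\rangle|\le\kappa\|x_1\|\|x_2\|$ for all $x_j\in\mathcal{H}_j\cap(\mathcal{H}_1\cap\mathcal{H}_2)^\perp$; $K_{\{0\}},K_{\{1\}}$ are $\varepsilon$-orthogonal if for every unitary representation $(\pi,\mathcal{H})$ of $G$, $\theta(\mathcal{H}^{\pi(K_{\{0\}})},\mathcal{H}^{\pi(K_{\{1\}})})\le\varepsilon$,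 where $\mathcal{H}^{\pi(K)}$ is the subspace of $\pi(K)$-invariant vectors. *)

theory Defs
  imports
    "HOL-Analysis.Analysis"
    "HOL-Algebra.Left_Coset"
    "HOL-Algebra.Generated_Groups"
    "HOL-Algebra.Group_Action"
    "HOL-Algebra.Module"
    "HOL-Algebra.Algebraic_Closure_Type"
begin

section \<open>Complex Hilbert spaces with explicit carriers\<close>

text \<open>
  Carriers are explicit so that one can quantify over all Hilbert spaces inside a formula. The
  vector space structure is a module over the field of complex numbers. The multiplicative fields
  that the record type inherits from rings play no role.
\<close>

record 'h chilbert = "(complex, 'h) module" +
  cinner :: "'h \<Rightarrow> 'h \<Rightarrow> complex"

definition hnorm :: "'h chilbert \<Rightarrow> 'h \<Rightarrow> real" where
  "hnorm H x = sqrt (Re (cinner H x x))"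

locale complex_hilbert_space = module "ring_of_type_algebra :: complex ring" H
  for H :: "'h chilbert" (structure) +
  assumes cinner_add_left:
      "\<lbrakk>x \<in> carrier H; y \<in> carrier H; z \<in> carrier H\<rbrakk>
        \<Longrightarrow> cinner H (x \<oplus> y) z = cinner H x z + cinner H y z"
    and cinner_smult_left:
      "\<lbrakk>x \<in> carrier H; y \<in> carrier H\<rbrakk> \<Longrightarrow> cinner H (a \<odot> x) y = a * cinner H x y"
    and cinner_commute:
      "\<lbrakk>x \<in> carrier H; y \<in> carrier H\<rbrakk> \<Longrightarrow> cinner H x y = cnj (cinner H y x)"
    and cinner_pos:
      "\<lbrakk>x \<in> carrier H; x \<noteq> \<zero>\<rbrakk> \<Longrightarrow> 0 < Re (cinner H x x)"
    and complete:
      "\<lbrakk>\<And>n. xs n \<in> carrier H;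
        \<And>e. 0 < e \<Longrightarrow> \<exists>N. \<forall>m\<ge>N. \<forall>n\<ge>N. hnorm H (xs m \<ominus> xs n) < e\<rbrakk>
        \<Longrightarrow> \<exists>l\<in>carrier H. (\<lambda>n. hnorm H (xs n \<ominus> l)) \<longlonglongrightarrow> 0"

definition orth_compl :: "'h chilbert \<Rightarrow> 'h set \<Rightarrow> 'h set" where
  "orth_compl H A = {x \<in> carrier H. \<forall>y\<in>A. cinner H x y = 0}"

text \<open>
  The infima below range over nonnegative constants. This only matters when one of the spaces
  involved is zero, where every real constant satisfies the inequality; the value is then 0.
\<close>

definition theta :: "'h chilbert \<Rightarrow> 'h set \<Rightarrow> 'h set \<Rightarrow> real" where
  "theta H A B = Inf {\<kappa>. 0 \<le> \<kappa> \<and>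
     (\<forall>x \<in> A \<inter> orth_compl H (A \<inter> B). \<forall>y \<in> B \<inter> orth_compl H (A \<inter> B).
        cmod (cinner H x y) \<le> \<kappa> * hnorm H x * hnorm H y)}"

definition op_norm_on :: "'a chilbert \<Rightarrow> 'b chilbert \<Rightarrow> 'a set \<Rightarrow> ('a \<Rightarrow> 'b) \<Rightarrow> real" where
  "op_norm_on H1 H2 A T = Inf {c. 0 \<le> c \<and> (\<forall>x\<in>A. hnorm H2 (T x) \<le> c * hnorm H1 x)}"


section \<open>Unitary representations of finite groups and orthogonality of subgroups\<close>

text \<open>
  For a finite, hence discrete, group no continuity condition is needed. A group action already makes
  every \<open>\<pi> g\<close> a bijection of the carrier.
\<close>

definition unitary_rep ::
    "('a, 'b) monoid_scheme \<Rightarrow> 'h chilbert \<Rightarrow> ('a \<Rightarrow> 'h \<Rightarrow> 'h) \<Rightarrow> bool" where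
  "unitary_rep G H \<pi> \<longleftrightarrow>
     complex_hilbert_space H \<and> group_action G (carrier H) \<pi> \<and>
     (\<forall>g\<in>carrier G.
        (\<forall>x\<in>carrier H. \<forall>y\<in>carrier H. \<pi> g (x \<oplus>\<^bsub>H\<^esub> y) = \<pi> g x \<oplus>\<^bsub>H\<^esub> \<pi> g y) \<and>
        (\<forall>a. \<forall>x\<in>carrier H. \<pi> g (a \<odot>\<^bsub>H\<^esub> x) = a \<odot>\<^bsub>H\<^esub> \<pi> g x) \<and>
        (\<forall>x\<in>carrier H. \<forall>y\<in>carrier H. cinner H (\<pi> g x) (\<pi> g y) = cinner H x y))"

definition invariant_vectors :: "'h chilbert \<Rightarrow> ('a \<Rightarrow> 'h \<Rightarrow> 'h) \<Rightarrow> 'a set \<Rightarrow> 'h set" where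
  "invariant_vectors H \<pi> K = {x \<in> carrier H. \<forall>k\<in>K. \<pi> k x = x}"

text \<open>
  A HOL formula cannot quantify over types, so the type argument is the universe from which the
  underlying sets of the Hilbert spaces are taken. It should have at least the cardinality of the
  complex numbers: over a smaller type the zero space is the only Hilbert space.
\<close>

definition eps_orthogonal ::
    "'h itself \<Rightarrow> ('a, 'b) monoid_scheme \<Rightarrow> 'a set \<Rightarrow> 'a set \<Rightarrow> real \<Rightarrow> bool" where
  "eps_orthogonal U G K0 K1 \<epsilon> \<longleftrightarrow>
     (\<forall>(H :: 'h chilbert) \<pi>. unitary_rep G H \<pi> \<longrightarrow>
        theta H (invariant_vectors H \<pi> K0) (invariant_vectors H \<pi> K1) \<le> \<epsilon>)"


section \<open>The bipartite coset graph\<close>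

text \<open>
  The sides are passed as two separate arguments throughout, so a coset belonging to both families
  still stands for two different vertices.
\<close>

definition nbrs :: "'a set set \<Rightarrow> 'a set \<Rightarrow> 'a set set" where
  "nbrs W v = {u \<in> W. u \<inter> v \<noteq> {}}"

text \<open>The common degree of the vertices in \<open>V\<close>, whose neighbours lie in \<open>W\<close>.\<close>

definition side_degree :: "'a set set \<Rightarrow> 'a set set \<Rightarrow> nat" where
  "side_degree V W = (THE d. \<forall>v\<in>V. card (nbrs W v) = d)"

lemma (in group) card_nbrs_lcosets:
  assumes K: "subgroup K G" and L: "subgroup L G" and v: "v \<in> lcosets K"
  shows "card (nbrs (lcosets L) v) = side_degree (lcosets K) (lcosets L)"
proof -
  have sub: "w \<subseteq> carrier G" if "w \<in> lcosets M" "subgroup M G" for w M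
    using that subgroup.lcosets_carrier[OF that(2) is_group that(1)] by simp
  have mem: "g <# w \<in> lcosets M" if "g \<in> carrier G" "w \<in> lcosets M" "subgroup M G" for g w M
    using that by (auto simp: LCOSETS_def lcos_m_assoc subgroup.subset)
  have cancel: "inv g <# (g <# w) = w" if "g \<in> carrier G" "w \<subseteq> carrier G" for g w
    using that by (simp add: lcos_m_assoc lcos_mult_one)
  have le: "bij_betw (\<lambda>w. g <# w) (nbrs (lcosets L) K) (nbrs (lcosets L) (g <# K))"
    if g: "g \<in> carrier G" for g
  proof (rule bij_betw_byWitness[where f' = "\<lambda>w. inv g <# w"])
    have KK: "K \<subseteq> carrier G" using K by (simp add: subgroup.subset)
    show "\<forall>w\<in>nbrs (lcosets L) K. inv g <# (g <# w) = w"
      using cancel g sub L by (auto simp: nbrs_def)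
    show "\<forall>w\<in>nbrs (lcosets L) (g <# K). g <# (inv g <# w) = w"
      using cancel[of "inv g"] g sub L by (auto simp: nbrs_def)
    have img: "(h <# w) \<inter> (h <# u) \<noteq> {}" if "w \<inter> u \<noteq> {}" for h w u
      using that by (auto simp: l_coset_def)
    show "(\<lambda>w. g <# w) ` nbrs (lcosets L) K \<subseteq> nbrs (lcosets L) (g <# K)"
      unfolding nbrs_def using mem[OF g _ L] img by blast
    show "(\<lambda>w. inv g <# w) ` nbrs (lcosets L) (g <# K) \<subseteq> nbrs (lcosets L) K"
    proof (clarify)
      fix w assume w: "w \<in> nbrs (lcosets L) (g <# K)"
      then have "(inv g <# w) \<inter> (inv g <# (g <# K)) \<noteq> {}"
        unfolding nbrs_def using img by blast
      then show "inv g <# w \<in> nbrs (lcosets L) K"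
        using w mem[of "inv g" w L] g L cancel[OF g KK] by (auto simp: nbrs_def)
    qed
  qed
  have card_eq: "card (nbrs (lcosets L) w) = card (nbrs (lcosets L) K)" if "w \<in> lcosets K" for w
    using that bij_betw_same_card[OF le] by (auto simp: LCOSETS_def)
  have "side_degree (lcosets K) (lcosets L) = card (nbrs (lcosets L) K)"
    unfolding side_degree_def
    by (rule the_equality) (use card_eq v in auto)
  then show ?thesis using card_eq[OF v] by simp
qed

text \<open>
  The space of functions on a finite side \<open>V\<close>, with the inner product weighted by \<open>d\<close>. Functions on
  \<open>V\<close> are represented extensionally.
\<close>

definition l2 :: "'v set \<Rightarrow> nat \<Rightarrow> ('v \<Rightarrow> complex) chilbert" where
  "l2 V d =
     \<lparr>carrier = extensional V, monoid.mult = undefined, one = undefined,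
      zero = (\<lambda>v\<in>V. 0), add = (\<lambda>\<phi> \<psi>. \<lambda>v\<in>V. \<phi> v + \<psi> v),
      smult = (\<lambda>a \<phi>. \<lambda>v\<in>V. a * \<phi> v),
      cinner = (\<lambda>\<phi> \<psi>. of_nat d * (\<Sum>v\<in>V. \<phi> v * cnj (\<psi> v)))\<rparr>"

definition l2_0 :: "'v set \<Rightarrow> nat \<Rightarrow> ('v \<Rightarrow> complex) set" where
  "l2_0 V d = {\<phi> \<in> carrier (l2 V d). (\<Sum>v\<in>V. \<phi> v) = 0}"

definition M0 :: "'a set set \<Rightarrow> 'a set set \<Rightarrow> ('a set \<Rightarrow> complex) \<Rightarrow> ('a set \<Rightarrow> complex)" where
  "M0 V0 V1 \<phi> = (\<lambda>v\<in>V1. (1 / of_nat (side_degree V1 V0)) * (\<Sum>u\<in>nbrs V0 v. \<phi> u))"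

text \<open>The norm of the restriction of \<open>M0\<close> to the functions with sum zero.\<close>

definition norm_M0 :: "'a set set \<Rightarrow> 'a set set \<Rightarrow> real" where
  "norm_M0 V0 V1 =
     op_norm_on (l2 V0 (side_degree V0 V1)) (l2 V1 (side_degree V1 V0))
       (l2_0 V0 (side_degree V0 V1)) (M0 V0 V1)"

end

theory Submission
  imports Defs
begin

text \<open>
  Both conditions say that on functions \<open>f\<close> on \<open>G\<close> that are right \<open>K0\<close>-invariant and sum to zero,
  averaging over \<open>K1\<close> has norm at most \<open>\<epsilon>\<close>. Functions on \<open>G/K0\<close> are such \<open>f\<close>, and \<open>M0\<close> becomes
  averaging over \<open>K1\<close>, since each neighbour of \<open>gK1\<close> is hit by \<open>|K0 \<inter> K1|\<close> elements of \<open>gK1\<close>.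
  In the right regular representation these \<open>f\<close> are \<open>K0\<close>-invariant vectors orthogonal to the
  constants, and averaging is the projection to the \<open>K1\<close>-invariant vectors. In an
  arbitrary representation the bound is applied to the matrix coefficients \<open>g \<mapsto> \<langle>\<pi>(g)x, z\<rangle>\<close>
  of a \<open>K0\<close>-invariant vector \<open>x\<close>, with \<open>z\<close> ranging over a finite Parseval frame for the vectors
  involved; summation over \<open>z\<close> gives the bound for the projection of \<open>x\<close> itself.
\<close>

section \<open>Infima of admissible constants\<close>

text \<open>The admissible constants form a closed set, so the infimum is itself admissible. The
  constant \<open>C\<close> witnesses that the set is nonempty. Both \<open>theta\<close> and
  \<open>op_norm_on\<close> are infima of this shape.\<close>

lemma Inf_bound_le_iff:
  fixes a b :: "'x \<Rightarrow> real"
  assumes "0 \<le> \<epsilon>" and b: "\<And>x. x \<in> A \<Longrightarrow> 0 \<le> b x"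
    and "0 \<le> C" and "\<And>x. x \<in> A \<Longrightarrow> a x \<le> C * b x"
  shows "Inf {c. 0 \<le> c \<and> (\<forall>x\<in>A. a x \<le> c * b x)} \<le> \<epsilon> \<longleftrightarrow> (\<forall>x\<in>A. a x \<le> \<epsilon> * b x)"
    (is "Inf ?S \<le> \<epsilon> \<longleftrightarrow> _")
proof
  have ne: "?S \<noteq> {}" using assms by auto
  have bdd: "bdd_below ?S" by (auto simp: bdd_below_def)
  assume le: "Inf ?S \<le> \<epsilon>"
  show "\<forall>x\<in>A. a x \<le> \<epsilon> * b x"
  proof
    fix x assume x: "x \<in> A"
    show "a x \<le> \<epsilon> * b x"
    proof (rule field_le_epsilon)
      fix e :: real assume e: "0 < e"
      have pos: "0 < b x + 1" using b[OF x] by simp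
      \<comment> \<open>The excess \<open>e / (b x + 1)\<close> costs at most \<open>e\<close> after
        multiplication by \<open>b x\<close>; the added 1 covers the case
        \<open>b x = 0\<close>.\<close>
      have "Inf ?S < \<epsilon> + e / (b x + 1)" using le e pos by (smt (verit) divide_pos_pos)
      then obtain c where c: "c \<in> ?S" "c < \<epsilon> + e / (b x + 1)"
        using cInf_less_iff[OF ne bdd] by auto
      have "a x \<le> c * b x" using c x by auto
      also have "\<dots> \<le> (\<epsilon> + e / (b x + 1)) * b x"
        using c b[OF x] by (intro mult_right_mono) auto
      also have "\<dots> = \<epsilon> * b x + e * (b x / (b x + 1))" by (simp add: field_simps)
      also have "\<dots> \<le> \<epsilon> * b x + e * 1"
        using e pos b[OF x] by (intro add_left_mono mult_left_mono) auto
      finally show "a x \<le> \<epsilon> * b x + e" by simp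
    qed
  qed
next
  assume "\<forall>x\<in>A. a x \<le> \<epsilon> * b x"
  then show "Inf ?S \<le> \<epsilon>"
    using assms(1) by (intro cInf_lower) (auto simp: bdd_below_def)
qed


section \<open>Geometry of an abstract complex Hilbert space\<close>

context complex_hilbert_space
begin

lemma scalar_ring [simp]:
  "carrier (ring_of_type_algebra :: complex ring) = UNIV"
  "add (ring_of_type_algebra :: complex ring) = (+)"
  "mult (ring_of_type_algebra :: complex ring) = (*)"
  by (simp_all add: ring_of_type_algebra_def)

lemma smult_carrier [simp]: "x \<in> carrier H \<Longrightarrow> a \<odot>\<^bsub>H\<^esub> x \<in> carrier H"
  by (rule smult_closed) auto

lemma cinner_zero_left [simp]: "z \<in> carrier H \<Longrightarrow> cinner H \<zero>\<^bsub>H\<^esub> z = 0"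
  using cinner_add_left[of "\<zero>\<^bsub>H\<^esub>" "\<zero>\<^bsub>H\<^esub>" z] by simp

lemma cinner_minus_left:
  "\<lbrakk>x \<in> carrier H; y \<in> carrier H; z \<in> carrier H\<rbrakk>
    \<Longrightarrow> cinner H (x \<ominus>\<^bsub>H\<^esub> y) z = cinner H x z - cinner H y z"
  using cinner_add_left[of "x \<ominus>\<^bsub>H\<^esub> y" y z] by (simp add: M.minus_eq M.add.m_assoc M.l_neg)

lemma cinner_smult_right:
  "\<lbrakk>x \<in> carrier H; y \<in> carrier H\<rbrakk> \<Longrightarrow> cinner H x (a \<odot>\<^bsub>H\<^esub> y) = cnj a * cinner H x y"
  by (metis cinner_smult_left cinner_commute complex_cnj_mult smult_carrier)

lemma Re_cinner_self_nonneg: "x \<in> carrier H \<Longrightarrow> 0 \<le> Re (cinner H x x)"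
  using cinner_pos[of x] by (cases "x = \<zero>\<^bsub>H\<^esub>") auto

lemma hnorm_power2: "x \<in> carrier H \<Longrightarrow> (hnorm H x)\<^sup>2 = Re (cinner H x x)"
  by (simp add: hnorm_def Re_cinner_self_nonneg)

lemma hnorm_nonneg: "x \<in> carrier H \<Longrightarrow> 0 \<le> hnorm H x"
  by (simp add: hnorm_def Re_cinner_self_nonneg)

lemma cinner_self:
  assumes "x \<in> carrier H"
  shows "cinner H x x = of_real ((hnorm H x)\<^sup>2)"
proof -
  have "Im (cinner H x x) = 0"
    using cinner_commute[OF assms assms] by (metis cnj.simps(2) neg_equal_0_iff_equal neg_equal_zero)
  then show ?thesis using hnorm_power2[OF assms] by (simp add: complex_eq_iff)
qed

lemma cinner_self_eq_0: "\<lbrakk>x \<in> carrier H; cinner H x x = 0\<rbrakk> \<Longrightarrow> x = \<zero>\<^bsub>H\<^esub>"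
  using cinner_pos[of x] by force

lemma cinner_eqI:
  assumes x: "x \<in> carrier H" and y: "y \<in> carrier H"
    and eq: "\<And>z. z \<in> carrier H \<Longrightarrow> cinner H x z = cinner H y z"
  shows "x = y"
proof -
  have "cinner H (x \<ominus>\<^bsub>H\<^esub> y) (x \<ominus>\<^bsub>H\<^esub> y) = 0"
    using x y eq by (simp add: cinner_minus_left)
  then have "x \<ominus>\<^bsub>H\<^esub> y = \<zero>\<^bsub>H\<^esub>" using x y by (intro cinner_self_eq_0) auto
  then show ?thesis using x y M.minus_equality[of x "\<ominus>\<^bsub>H\<^esub> y"] by (simp add: M.minus_eq)
qed

text \<open>This is the component of \<open>v\<close> orthogonal to \<open>w\<close>, not the one
  along \<open>w\<close>. For \<open>w\<close> zero, division by zero gives 0 and the map is the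
  identity on the carrier.\<close>

definition orth_proj :: "'h \<Rightarrow> 'h \<Rightarrow> 'h" where
  "orth_proj w v = v \<oplus>\<^bsub>H\<^esub> (- (cinner H v w / cinner H w w)) \<odot>\<^bsub>H\<^esub> w"

lemma orth_proj_carrier [simp]:
  "\<lbrakk>w \<in> carrier H; v \<in> carrier H\<rbrakk> \<Longrightarrow> orth_proj w v \<in> carrier H"
  by (simp add: orth_proj_def)

lemma cinner_orth_proj_left:
  "\<lbrakk>w \<in> carrier H; v \<in> carrier H; z \<in> carrier H\<rbrakk>
    \<Longrightarrow> cinner H (orth_proj w v) z = cinner H v z - cinner H v w * cinner H w z / cinner H w w"
  by (simp add: orth_proj_def cinner_add_left cinner_smult_left)

lemma cinner_orth_proj_right:
  assumes "w \<in> carrier H" "v \<in> carrier H" "z \<in> carrier H"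
  shows "cinner H v (orth_proj w z) = cinner H (orth_proj w v) z"
proof -
  have "cinner H v (orth_proj w z) = cnj (cinner H (orth_proj w z) v)"
    using assms by (intro cinner_commute) auto
  also have "\<dots> = cinner H (orth_proj w v) z"
    using assms cinner_commute[of v z] cinner_commute[of v w] cinner_commute[of w z]
      cinner_commute[of w w]
    by (simp add: cinner_orth_proj_left)
  finally show ?thesis .
qed

text \<open>Pythagoras: the projection is self-adjoint and, for nonzero \<open>w\<close>,
  idempotent, so the squared norm of the residual equals its inner product with
  \<open>v\<close>.\<close>

lemma cinner_orth_proj_self:
  assumes "w \<in> carrier H" "v \<in> carrier H" "w \<noteq> \<zero>\<^bsub>H\<^esub>"
  shows "Re (cinner H (orth_proj w v) (orth_proj w v))
    = Re (cinner H v v) - (cmod (cinner H v w))\<^sup>2 / Re (cinner H w w)"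
proof -
  have ww: "cinner H w w \<noteq> 0" using assms cinner_self_eq_0 by blast
  have "cinner H (orth_proj w v) (orth_proj w v) = cinner H (orth_proj w (orth_proj w v)) v"
    using assms by (simp add: cinner_orth_proj_right)
  also have "\<dots> = cinner H v v - cinner H v w * cinner H w v / cinner H w w"
    using assms ww by (simp add: cinner_orth_proj_left)
  also have "cinner H v w * cinner H w v = of_real ((cmod (cinner H v w))\<^sup>2)"
    using assms cinner_commute[of w v] complex_norm_square[of "cinner H v w"] by simp
  finally show ?thesis using cinner_self[OF assms(1)] hnorm_power2[OF assms(1)]
    by (metis Re_complex_of_real minus_complex.simps(1) of_real_divide)
qed

lemma Cauchy_Schwarz:
  assumes "x \<in> carrier H" "y \<in> carrier H"
  shows "cmod (cinner H x y) \<le> hnorm H x * hnorm H y"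
proof (cases "y = \<zero>\<^bsub>H\<^esub>")
  case True
  then show ?thesis using assms cinner_commute[of x y] by (simp add: hnorm_def)
next
  case False
  have pos: "0 < (hnorm H y)\<^sup>2" using False assms cinner_pos hnorm_power2 by simp
  \<comment> \<open>Cauchy-Schwarz amounts to the nonnegativity of the squared norm of
    \<open>orth_proj y x\<close>.\<close>
  have "0 \<le> (hnorm H x)\<^sup>2 - (cmod (cinner H x y))\<^sup>2 / (hnorm H y)\<^sup>2"
    using cinner_orth_proj_self[OF assms(2,1) False] Re_cinner_self_nonneg[of "orth_proj y x"] assms
    by (simp add: hnorm_power2)
  then have "(cmod (cinner H x y))\<^sup>2 \<le> (hnorm H x * hnorm H y)\<^sup>2"
    using pos by (simp add: field_simps)
  then show ?thesis using assms hnorm_nonneg by (meson mult_nonneg_nonneg power2_le_imp_le)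
qed

text \<open>A vector is determined by its inner products (\<open>cinner_eqI\<close>), so this
  describes the sum of the \<open>f i\<close> completely.\<close>

lemma vector_sum_exists:
  assumes "finite I" "\<And>i. i \<in> I \<Longrightarrow> f i \<in> carrier H"
  shows "\<exists>p\<in>carrier H. \<forall>z\<in>carrier H. cinner H p z = (\<Sum>i\<in>I. cinner H (f i) z)"
  using assms
proof (induction I)
  case empty
  show ?case by (rule bexI[of _ "\<zero>\<^bsub>H\<^esub>"]) auto
next
  case (insert i I)
  then obtain p where "p \<in> carrier H" "\<forall>z\<in>carrier H. cinner H p z = (\<Sum>i\<in>I. cinner H (f i) z)"
    by auto
  with insert show ?case
    by (intro bexI[of _ "f i \<oplus>\<^bsub>H\<^esub> p"]) (auto simp: cinner_add_left)
qed

text \<open>Coordinates for a finite configuration of vectors: a Parseval frame for their span, obtained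
  by splitting off one vector at a time.\<close>

lemma finite_Parseval:
  assumes "finite I" "\<And>i. i \<in> I \<Longrightarrow> f i \<in> carrier H"
  shows "\<exists>zs. set zs \<subseteq> carrier H \<and>
    (\<forall>i\<in>I. Re (cinner H (f i) (f i)) = (\<Sum>z\<leftarrow>zs. (cmod (cinner H (f i) z))\<^sup>2))"
  using assms
proof (induction I arbitrary: f)
  case empty
  show ?case by (rule exI[of _ "[]"]) auto
next
  case (insert k I)
  define w where "w = f k"
  have w: "w \<in> carrier H" using insert by (simp add: w_def)
  have f: "f i \<in> carrier H" if "i \<in> I" for i using insert that by simp
  show ?case
  proof (cases "w = \<zero>\<^bsub>H\<^esub>")
    case True
    obtain zs where zs: "set zs \<subseteq> carrier H"
      "\<forall>i\<in>I. Re (cinner H (f i) (f i)) = (\<Sum>z\<leftarrow>zs. (cmod (cinner H (f i) z))\<^sup>2)"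
      using insert.IH[of f] f by blast
    have "(\<Sum>z\<leftarrow>zs. (cmod (cinner H w z))\<^sup>2) = (\<Sum>z\<leftarrow>zs. 0)"
      using zs True by (intro arg_cong[where f = sum_list] map_cong) auto
    then show ?thesis using zs True by (intro exI[of _ zs]) (auto simp: w_def)
  next
    case False
    define r where "r = hnorm H w"
    have r: "0 < r" "Re (cinner H w w) = r\<^sup>2"
      using cinner_pos[OF w False] hnorm_power2[OF w] by (simp_all add: r_def hnorm_def)
    \<comment> \<open>The induction is over all families, so the hypothesis applies to the residuals
      of the remaining vectors after \<open>w\<close> is split off.\<close>
    obtain zs where zs: "set zs \<subseteq> carrier H"
      "\<And>i. i \<in> I \<Longrightarrow> Re (cinner H (orth_proj w (f i)) (orth_proj w (f i)))
        = (\<Sum>z\<leftarrow>zs. (cmod (cinner H (orth_proj w (f i)) z))\<^sup>2)"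
      using insert.IH[of "\<lambda>i. orth_proj w (f i)"] f w by auto
    \<comment> \<open>The new frame is the unit vector along \<open>w\<close> together with the
      projected old frame. By self-adjointness, pairing \<open>v\<close> with a projected vector is
      pairing the residual of \<open>v\<close> with the old one.\<close>
    define zs' where "zs' = (of_real (1 / r) \<odot>\<^bsub>H\<^esub> w) # map (orth_proj w) zs"
    have sum: "(\<Sum>z\<leftarrow>zs'. (cmod (cinner H v z))\<^sup>2)
      = (cmod (cinner H v w))\<^sup>2 / r\<^sup>2 + (\<Sum>z\<leftarrow>zs. (cmod (cinner H (orth_proj w v) z))\<^sup>2)"
      if v: "v \<in> carrier H" for v
    proof -
      have "(\<Sum>z\<leftarrow>map (orth_proj w) zs. (cmod (cinner H v z))\<^sup>2)
          = (\<Sum>z\<leftarrow>zs. (cmod (cinner H (orth_proj w v) z))\<^sup>2)"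
        using zs v w
        by (auto simp: cinner_orth_proj_right subset_eq intro!: arg_cong[where f = sum_list])
      then show ?thesis
        using v w r
        by (simp add: zs'_def cinner_smult_right norm_mult norm_divide power_mult_distrib power_divide)
    qed
    have "cinner H w w \<noteq> 0" using cinner_self_eq_0[OF w] False by blast
    then have ww: "orth_proj w w = \<zero>\<^bsub>H\<^esub>"
      using w by (intro cinner_eqI) (simp_all add: cinner_orth_proj_left)
    \<comment> \<open>Since \<open>w\<close> has zero residual, only the first frame vector
      contributes to its norm.\<close>
    have "(\<Sum>z\<leftarrow>zs. (cmod (cinner H (orth_proj w w) z))\<^sup>2) = (\<Sum>z\<leftarrow>zs. 0)"
      using zs ww by (intro arg_cong[where f = sum_list] map_cong) auto
    then have "Re (cinner H w w) = (\<Sum>z\<leftarrow>zs'. (cmod (cinner H w z))\<^sup>2)"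
      using sum[OF w] r cinner_self[OF w]
      by (simp add: r_def[symmetric] power2_eq_square norm_mult)
    moreover have "Re (cinner H (f i) (f i)) = (\<Sum>z\<leftarrow>zs'. (cmod (cinner H (f i) z))\<^sup>2)"
      if "i \<in> I" for i
      using sum[OF f[OF that]] zs(2)[OF that] cinner_orth_proj_self[OF w f[OF that] False] r
      by simp
    moreover have "set zs' \<subseteq> carrier H" using zs w by (auto simp: zs'_def)
    ultimately show ?thesis by (intro exI[of _ zs']) (auto simp: w_def)
  qed
qed


text \<open>This is \<open>Inf_bound_le_iff\<close> over pairs of vectors, with Cauchy-Schwarz
  making 1 an admissible constant.\<close>

lemma theta_le_iff:
  assumes "A \<subseteq> carrier H" "B \<subseteq> carrier H" "0 \<le> \<epsilon>"
  shows "theta H A B \<le> \<epsilon> \<longleftrightarrow>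
    (\<forall>x \<in> A \<inter> orth_compl H (A \<inter> B). \<forall>y \<in> B \<inter> orth_compl H (A \<inter> B).
      cmod (cinner H x y) \<le> \<epsilon> * hnorm H x * hnorm H y)"
proof -
  let ?P = "(A \<inter> orth_compl H (A \<inter> B)) \<times> (B \<inter> orth_compl H (A \<inter> B))"
  have sub: "fst p \<in> carrier H" "snd p \<in> carrier H" if "p \<in> ?P" for p
    using that assms by auto
  have "theta H A B = Inf {c. 0 \<le> c \<and>
      (\<forall>p\<in>?P. cmod (cinner H (fst p) (snd p)) \<le> c * (hnorm H (fst p) * hnorm H (snd p)))}"
    unfolding theta_def by (intro arg_cong[where f = Inf]) (auto simp: mult.assoc)
  also have "\<dots> \<le> \<epsilon> \<longleftrightarrow>
      (\<forall>p\<in>?P. cmod (cinner H (fst p) (snd p)) \<le> \<epsilon> * (hnorm H (fst p) * hnorm H (snd p)))"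
    by (rule Inf_bound_le_iff[where C = 1])
      (use assms sub hnorm_nonneg Cauchy_Schwarz in \<open>auto intro!: mult_nonneg_nonneg\<close>)
  finally show ?thesis by (auto simp: mult.assoc)
qed

end


section \<open>From the averaging bound to all unitary representations\<close>

context group
begin

text \<open>The inner sum over \<open>L\<close> is \<open>card L\<close> times the average, hence
  the factor on the right; comparing squared norms keeps roots and division out.\<close>

definition averaging_bound :: "'a set \<Rightarrow> 'a set \<Rightarrow> real \<Rightarrow> bool" where
  "averaging_bound K L \<epsilon> \<longleftrightarrow>
    (\<forall>f :: 'a \<Rightarrow> complex.
      (\<forall>g\<in>carrier G. \<forall>k\<in>K. f (g \<otimes> k) = f g) \<longrightarrow> (\<Sum>g\<in>carrier G. f g) = 0 \<longrightarrow>
      (\<Sum>g\<in>carrier G. (cmod (\<Sum>k\<in>L. f (g \<otimes> k)))\<^sup>2)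
        \<le> (\<epsilon> * card L)\<^sup>2 * (\<Sum>g\<in>carrier G. (cmod (f g))\<^sup>2))"

lemma sum_translate_left:
  assumes "h \<in> carrier G"
  shows "(\<Sum>g\<in>carrier G. f (h \<otimes> g)) = (\<Sum>g\<in>carrier G. f g)"
  by (rule sum.reindex_bij_witness[where i = "\<lambda>g. inv h \<otimes> g" and j = "\<lambda>g. h \<otimes> g"])
    (use assms in \<open>auto simp: m_assoc[symmetric]\<close>)

lemma sum_translate_right:
  assumes "h \<in> carrier G"
  shows "(\<Sum>g\<in>carrier G. f (g \<otimes> h)) = (\<Sum>g\<in>carrier G. f g)"
  by (rule sum.reindex_bij_witness[where i = "\<lambda>g. g \<otimes> inv h" and j = "\<lambda>g. g \<otimes> h"])
    (use assms in \<open>auto simp: m_assoc\<close>)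

text \<open>Pairing \<open>x\<close> with an \<open>L\<close>-invariant \<open>y\<close> only sees
  the projection of \<open>x\<close> to the \<open>L\<close>-invariant vectors, so it suffices to
  bound that projection; its norm is recovered from matrix coefficients.\<close>

lemma averaging_bound_imp_theta_le:
  fixes H :: "'h chilbert"
  assumes fin: "finite (carrier G)" and K: "subgroup K G" and L: "subgroup L G" and eps: "0 \<le> \<epsilon>"
    and bound: "averaging_bound K L \<epsilon>" and rep: "unitary_rep G H \<pi>"
  shows "theta H (invariant_vectors H \<pi> K) (invariant_vectors H \<pi> L) \<le> \<epsilon>"
proof -
  interpret H: complex_hilbert_space H using rep by (simp add: unitary_rep_def)
  interpret act: group_action G "carrier H" \<pi> using rep by (simp add: unitary_rep_def)
  have closed [simp]: "\<pi> g x \<in> carrier H" if "g \<in> carrier G" "x \<in> carrier H" for g x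
    using act.element_image[OF that refl] .
  have comp: "\<pi> (g \<otimes> h) x = \<pi> g (\<pi> h x)"
    if "g \<in> carrier G" "h \<in> carrier G" "x \<in> carrier H" for g h x
    using act.composition_rule that by blast
  have one: "\<pi> \<one> x = x" if "x \<in> carrier H" for x
    using act.id_eq_one that by (metis restrict_apply)
  have isometric: "cinner H (\<pi> g x) (\<pi> g y) = cinner H x y"
    if "g \<in> carrier G" "x \<in> carrier H" "y \<in> carrier H" for g x y
    using rep that by (simp add: unitary_rep_def)
  have adjoint: "cinner H (\<pi> g x) y = cinner H x (\<pi> (inv g) y)"
    if "g \<in> carrier G" "x \<in> carrier H" "y \<in> carrier H" for g x y
    using isometric[of g x "\<pi> (inv g) y"] that comp[of g "inv g" y] one by simp
  have KG: "k \<in> carrier G" if "k \<in> K" for k using subgroup.mem_carrier[OF K that] .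
  have LG: "k \<in> carrier G" if "k \<in> L" for k using subgroup.mem_carrier[OF L that] .
  have finL: "finite L" using fin LG by (meson finite_subset subsetI)
  have cardL: "0 < card L" using finL L subgroup.one_closed by (metis card_gt_0_iff empty_iff)
  let ?A = "invariant_vectors H \<pi> K" and ?B = "invariant_vectors H \<pi> L"
  have "cmod (cinner H x y) \<le> \<epsilon> * hnorm H x * hnorm H y"
    if "x \<in> ?A" "x \<in> orth_compl H (?A \<inter> ?B)" "y \<in> ?B" for x y
  proof -
    have x: "x \<in> carrier H" "\<And>k. k \<in> K \<Longrightarrow> \<pi> k x = x"
      and y: "y \<in> carrier H" "\<And>k. k \<in> L \<Longrightarrow> \<pi> k y = y"
      using that by (auto simp: invariant_vectors_def)
    \<comment> \<open>The orbit sum \<open>q\<close> is fixed by the whole group, so it lies in both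
      invariant spaces and is orthogonal to \<open>x\<close>. Hence it vanishes, which is the
      sum-zero condition for the coefficients of \<open>x\<close>.\<close>
    obtain q where q: "q \<in> carrier H"
      "\<And>z. z \<in> carrier H \<Longrightarrow> cinner H q z = (\<Sum>g\<in>carrier G. cinner H (\<pi> g x) z)"
      using H.vector_sum_exists[OF fin, of "\<lambda>g. \<pi> g x"] x by auto
    have q_inv: "\<pi> h q = q" if h: "h \<in> carrier G" for h
    proof (rule H.cinner_eqI)
      fix z assume z: "z \<in> carrier H"
      have "cinner H (\<pi> h q) z = (\<Sum>g\<in>carrier G. cinner H (\<pi> g x) (\<pi> (inv h) z))"
        using h z q by (simp add: adjoint)
      also have "\<dots> = (\<Sum>g\<in>carrier G. cinner H (\<pi> (h \<otimes> g) x) z)"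
        using h z x by (intro sum.cong) (auto simp: adjoint comp)
      also have "\<dots> = cinner H q z"
        using q z sum_translate_left[OF h, of "\<lambda>g. cinner H (\<pi> g x) z"] by simp
      finally show "cinner H (\<pi> h q) z = cinner H q z" .
    qed (use h q in auto)
    have "cinner H x q = 0"
      using that(2) q(1) q_inv KG LG by (auto simp: orth_compl_def invariant_vectors_def)
    \<comment> \<open>Moving each \<open>\<pi> g\<close> across turns \<open>cinner H q q\<close>
      into \<open>card (carrier G)\<close> copies of \<open>cinner H x q\<close>.\<close>
    then have "cinner H q q = 0" using q x q_inv by (simp add: adjoint)
    then have q0: "q = \<zero>\<^bsub>H\<^esub>" using H.cinner_self_eq_0 q(1) by blast

    \<comment> \<open>\<open>p\<close> is \<open>card L\<close> times the projection of
      \<open>x\<close> to the \<open>L\<close>-invariant vectors.\<close>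
    obtain p where p: "p \<in> carrier H"
      "\<And>z. z \<in> carrier H \<Longrightarrow> cinner H p z = (\<Sum>k\<in>L. cinner H (\<pi> k x) z)"
      using H.vector_sum_exists[OF finL, of "\<lambda>g. \<pi> g x"] x LG by auto
    have pi_p: "cinner H (\<pi> g p) z = (\<Sum>k\<in>L. cinner H (\<pi> (g \<otimes> k) x) z)"
      if "g \<in> carrier G" "z \<in> carrier H" for g z
      using that x p LG by (auto simp: adjoint comp intro!: sum.cong)
    \<comment> \<open>One frame must serve the whole orbits of \<open>x\<close> and
      \<open>p\<close>, since coefficients are summed over the group.\<close>
    have "\<exists>zs. set zs \<subseteq> carrier H \<and>
      (\<forall>i\<in>carrier G \<times> {x, p}. Re (cinner H (\<pi> (fst i) (snd i)) (\<pi> (fst i) (snd i)))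
        = (\<Sum>z\<leftarrow>zs. (cmod (cinner H (\<pi> (fst i) (snd i)) z))\<^sup>2))"
      using fin x p by (intro H.finite_Parseval) auto
    then obtain zs where zs: "set zs \<subseteq> carrier H"
      "\<And>g w. \<lbrakk>g \<in> carrier G; w \<in> {x, p}\<rbrakk>
        \<Longrightarrow> Re (cinner H (\<pi> g w) (\<pi> g w)) = (\<Sum>z\<leftarrow>zs. (cmod (cinner H (\<pi> g w) z))\<^sup>2)"
      by fastforce
    \<comment> \<open>By unitarity each group element contributes the same squared norm; exchanging
      the sums leaves one coefficient function per frame vector.\<close>
    have norm_sum: "card (carrier G) * (hnorm H w)\<^sup>2
        = (\<Sum>z\<leftarrow>zs. \<Sum>g\<in>carrier G. (cmod (cinner H (\<pi> g w) z))\<^sup>2)" if w: "w \<in> {x, p}" for w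
    proof -
      have "card (carrier G) * (hnorm H w)\<^sup>2 = (\<Sum>g\<in>carrier G. Re (cinner H (\<pi> g w) (\<pi> g w)))"
        using w x p by (auto simp: isometric H.hnorm_power2)
      also have "\<dots> = (\<Sum>g\<in>carrier G. \<Sum>z\<leftarrow>zs. (cmod (cinner H (\<pi> g w) z))\<^sup>2)"
        using w by (intro sum.cong refl zs(2))
      also have "\<dots> = (\<Sum>z\<leftarrow>zs. \<Sum>g\<in>carrier G. (cmod (cinner H (\<pi> g w) z))\<^sup>2)"
        by (induction zs) (simp_all add: sum.distrib)
      finally show ?thesis .
    qed
    have "(\<Sum>g\<in>carrier G. (cmod (cinner H (\<pi> g p) z))\<^sup>2)
        \<le> (\<epsilon> * card L)\<^sup>2 * (\<Sum>g\<in>carrier G. (cmod (cinner H (\<pi> g x) z))\<^sup>2)"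
      if "z \<in> set zs" for z
    proof -
      have z: "z \<in> carrier H" using zs that by auto
      \<comment> \<open>The coefficient function of \<open>x\<close> and \<open>z\<close> is right
        \<open>K\<close>-invariant because \<open>K\<close> fixes \<open>x\<close>, and it sums to
        \<open>cinner H q z\<close>, which is 0.\<close>
      have "(\<Sum>g\<in>carrier G. (cmod (\<Sum>k\<in>L. cinner H (\<pi> (g \<otimes> k) x) z))\<^sup>2)
        \<le> (\<epsilon> * card L)\<^sup>2 * (\<Sum>g\<in>carrier G. (cmod (cinner H (\<pi> g x) z))\<^sup>2)"
        using bound[unfolded averaging_bound_def, rule_format, of "\<lambda>g. cinner H (\<pi> g x) z"]
          q(2)[OF z] q0 z x KG by (simp add: comp)
      then show ?thesis using pi_p z by simp
    qed
    then have "card (carrier G) * (hnorm H p)\<^sup>2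
        \<le> (\<epsilon> * card L)\<^sup>2 * (card (carrier G) * (hnorm H x)\<^sup>2)"
      by (simp add: norm_sum sum_list_const_mult[symmetric] sum_list_mono)
    moreover have "0 < card (carrier G)" using fin one_closed by (metis card_gt_0_iff empty_iff)
    ultimately have "(hnorm H p)\<^sup>2 \<le> (\<epsilon> * card L * hnorm H x)\<^sup>2"
      by (simp add: power_mult_distrib mult.left_commute)
    then have hp: "hnorm H p \<le> \<epsilon> * card L * hnorm H x"
      using eps H.hnorm_nonneg x by (meson mult_nonneg_nonneg of_nat_0_le_iff power2_le_imp_le)
    \<comment> \<open>The adjoint of \<open>\<pi> k\<close> fixes \<open>y\<close>, so all terms of
      \<open>cinner H p y\<close> are equal.\<close>
    have "cinner H (\<pi> k x) y = cinner H x y" if "k \<in> L" for k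
      using that x y LG subgroup.m_inv_closed[OF L] by (simp add: adjoint)
    then have "cinner H p y = card L * cinner H x y" using p y by simp
    then have "card L * cmod (cinner H x y) \<le> hnorm H p * hnorm H y"
      using H.Cauchy_Schwarz[of p y] p y by (simp add: norm_mult)
    also have "\<dots> \<le> \<epsilon> * card L * hnorm H x * hnorm H y"
      using hp H.hnorm_nonneg y by (simp add: mult_right_mono)
    finally have "card L * cmod (cinner H x y) \<le> card L * (\<epsilon> * hnorm H x * hnorm H y)"
      by (simp add: mult_ac)
    then show ?thesis using cardL by simp
  qed
  then show ?thesis
    using eps by (subst H.theta_le_iff) (auto simp: invariant_vectors_def)
qed

section \<open>Cosets, degrees and the operator \<open>M0\<close>\<close>

lemma lcos_eq_iff:
  assumes K: "subgroup K G" and "g \<in> carrier G" "h \<in> carrier G"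
  shows "g <# K = h <# K \<longleftrightarrow> inv g \<otimes> h \<in> K"
proof -
  have "g <# K = h <# K \<longleftrightarrow> h \<in> g <# K"
    using assms by (metis lcos_self l_repr_independence subgroup.subset)
  also have "\<dots> \<longleftrightarrow> inv g \<otimes> h \<in> K"
    using assms subgroup.lcos_module_imp[OF K is_group] subgroup.lcos_module_rev[OF K is_group]
    by blast
  finally show ?thesis .
qed

text \<open>Each point \<open>g \<otimes> k\<close> of \<open>g <# L\<close> lies in exactly one
  left coset of \<open>K\<close>.\<close>

lemma nbrs_lcosets:
  assumes K: "subgroup K G" and L: "subgroup L G" and g: "g \<in> carrier G"
  shows "nbrs (lcosets K) (g <# L) = (\<lambda>k. (g \<otimes> k) <# K) ` L"
proof (intro equalityI subsetI)
  fix u assume "u \<in> nbrs (lcosets K) (g <# L)"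
  then obtain h k where h: "h \<in> carrier G" "u = h <# K" and k: "k \<in> L" "g \<otimes> k \<in> u"
    unfolding nbrs_def LCOSETS_def using l_coset_def[of G g L] by auto
  have "u = (g \<otimes> k) <# K"
    using h k l_repr_independence[OF _ h(1) K] by blast
  then show "u \<in> (\<lambda>k. (g \<otimes> k) <# K) ` L" using k by blast
next
  fix u assume "u \<in> (\<lambda>k. (g \<otimes> k) <# K) ` L"
  then obtain k where k: "k \<in> L" "u = (g \<otimes> k) <# K" by blast
  have "k \<in> carrier G" using k subgroup.mem_carrier[OF L] by blast
  then have "g \<otimes> k \<in> u" "u \<in> lcosets K" using k g lcos_self[OF _ K] by (auto simp: LCOSETS_def)
  moreover have "g \<otimes> k \<in> g <# L" using k by (auto simp: l_coset_def)
  ultimately show "u \<in> nbrs (lcosets K) (g <# L)" by (auto simp: nbrs_def)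
qed

text \<open>A fibre of \<open>k \<mapsto> (g \<otimes> k) <# K\<close> on \<open>L\<close> is a left
  translate of \<open>K \<inter> L\<close>, so every neighbour is hit equally often.\<close>

lemma sum_over_coset:
  fixes \<phi> :: "'a set \<Rightarrow> 'c :: semiring_1"
  assumes fin: "finite (carrier G)" and K: "subgroup K G" and L: "subgroup L G" and g: "g \<in> carrier G"
  shows "(\<Sum>k\<in>L. \<phi> ((g \<otimes> k) <# K)) = of_nat (card (K \<inter> L)) * (\<Sum>u\<in>nbrs (lcosets K) (g <# L). \<phi> u)"
proof -
  have LG: "k \<in> carrier G" if "k \<in> L" for k using subgroup.mem_carrier[OF L that] .
  have KG: "k \<in> carrier G" if "k \<in> K" for k using subgroup.mem_carrier[OF K that] .
  have finL: "finite L" using fin LG by (meson finite_subset subsetI)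
  have card: "card {k\<in>L. (g \<otimes> k) <# K = u} = card (K \<inter> L)" if u: "u \<in> nbrs (lcosets K) (g <# L)" for u
  proof -
    obtain l where l: "l \<in> L" "u = (g \<otimes> l) <# K" using u nbrs_lcosets[OF K L g] by auto
    have iff: "(g \<otimes> k) <# K = u \<longleftrightarrow> inv l \<otimes> k \<in> K" if k: "k \<in> L" for k
    proof -
      have "(g \<otimes> k) <# K = u \<longleftrightarrow> inv (g \<otimes> l) \<otimes> (g \<otimes> k) \<in> K"
        using l k g LG by (auto simp: lcos_eq_iff[OF K, symmetric])
      also have "inv (g \<otimes> l) \<otimes> (g \<otimes> k) = inv l \<otimes> k"
        using l k g LG by (simp add: inv_mult_group m_assoc inv_solve_left')
      finally show ?thesis .
    qed
    have "bij_betw (\<lambda>k. inv l \<otimes> k) {k\<in>L. inv l \<otimes> k \<in> K} (K \<inter> L)"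
      by (rule bij_betw_byWitness[where f' = "\<lambda>k. l \<otimes> k"])
        (use l LG subgroup.m_closed[OF L] subgroup.m_inv_closed[OF L]
          in \<open>auto simp: m_assoc[symmetric]\<close>)
    moreover have "{k\<in>L. (g \<otimes> k) <# K = u} = {k\<in>L. inv l \<otimes> k \<in> K}" using iff by blast
    ultimately show ?thesis by (simp add: bij_betw_same_card)
  qed
  have "(\<Sum>k\<in>L. \<phi> ((g \<otimes> k) <# K))
      = (\<Sum>u\<in>nbrs (lcosets K) (g <# L). of_nat (card {k\<in>L. (g \<otimes> k) <# K = u}) * \<phi> u)"
    using finL nbrs_lcosets[OF K L g] by (intro sum_fun_comp) auto
  also have "\<dots> = of_nat (card (K \<inter> L)) * (\<Sum>u\<in>nbrs (lcosets K) (g <# L). \<phi> u)"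
    by (simp add: card sum_distrib_left)
  finally show ?thesis .
qed

text \<open>The case of \<open>sum_over_coset\<close> in which \<open>L\<close> is the whole group:
  every coset of \<open>K\<close> is then a neighbour.\<close>

lemma sum_over_lcosets:
  fixes \<phi> :: "'a set \<Rightarrow> 'c :: semiring_1"
  assumes fin: "finite (carrier G)" and K: "subgroup K G"
  shows "(\<Sum>g\<in>carrier G. \<phi> (g <# K)) = of_nat (card K) * (\<Sum>u\<in>lcosets K. \<phi> u)"
proof -
  have "\<one> <# carrier G = carrier G" by (simp add: lcos_mult_one)
  moreover have "nbrs (lcosets K) (carrier G) = lcosets K"
    using nbrs_lcosets[OF K subgroup_self one_closed] by (auto simp: lcos_mult_one LCOSETS_def)
  moreover have "K \<inter> carrier G = K" using subgroup.subset[OF K] by blast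
  ultimately show ?thesis using sum_over_coset[OF fin K subgroup_self one_closed, of \<phi>] by simp
qed

text \<open>Obtained by counting \<open>L\<close> with the constant function 1 in
  \<open>sum_over_coset\<close>. It ties the degree weights of the graph to subgroup orders.\<close>

lemma card_Int_side_degree:
  assumes fin: "finite (carrier G)" and K: "subgroup K G" and L: "subgroup L G"
  shows "card (K \<inter> L) * side_degree (lcosets L) (lcosets K) = card L"
proof -
  have "\<one> <# L \<in> lcosets L" by (auto simp: LCOSETS_def)
  then show ?thesis
    using sum_over_coset[OF fin K L one_closed, of "\<lambda>_. 1 :: nat"] card_nbrs_lcosets[OF L K] by simp
qed

text \<open>By right \<open>K\<close>-invariance the representative picked by \<open>SOME\<close>
  does not matter.\<close>

lemma lcosets_function_lift:
  assumes K: "subgroup K G" and f: "\<And>g k. \<lbrakk>g \<in> carrier G; k \<in> K\<rbrakk> \<Longrightarrow> f (g \<otimes> k) = f g"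
  obtains \<phi> where "\<phi> \<in> extensional (lcosets K)" "\<And>g. g \<in> carrier G \<Longrightarrow> \<phi> (g <# K) = f g"
proof
  show "(\<lambda>u\<in>lcosets K. f (SOME g. g \<in> u)) \<in> extensional (lcosets K)" by simp
  fix g assume g: "g \<in> carrier G"
  have "(SOME h. h \<in> g <# K) \<in> g <# K" using lcos_self[OF g K] by (rule someI)
  then have "f (SOME h. h \<in> g <# K) = f g" using f g by (auto simp: l_coset_def)
  then show "(\<lambda>u\<in>lcosets K. f (SOME g. g \<in> u)) (g <# K) = f g"
    using g by (auto simp: LCOSETS_def)
qed

text \<open>Cauchy-Schwarz over \<open>L\<close>, then right translation by each \<open>k\<close>.
  It makes 1 an admissible constant for the norm of \<open>M0\<close>.\<close>

lemma averaging_contraction: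
  fixes f :: "'a \<Rightarrow> complex"
  assumes fin: "finite (carrier G)" and L: "subgroup L G"
  shows "(\<Sum>g\<in>carrier G. (cmod (\<Sum>k\<in>L. f (g \<otimes> k)))\<^sup>2)
    \<le> (card L)\<^sup>2 * (\<Sum>g\<in>carrier G. (cmod (f g))\<^sup>2)"
proof -
  have LG: "k \<in> carrier G" if "k \<in> L" for k using subgroup.mem_carrier[OF L that] .
  have "(cmod (\<Sum>k\<in>L. f (g \<otimes> k)))\<^sup>2 \<le> card L * (\<Sum>k\<in>L. (cmod (f (g \<otimes> k)))\<^sup>2)" for g
  proof -
    have "(cmod (\<Sum>k\<in>L. f (g \<otimes> k)))\<^sup>2 \<le> (\<Sum>k\<in>L. cmod (f (g \<otimes> k)))\<^sup>2"
      by (intro power_mono norm_sum norm_ge_zero)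
    also have "\<dots> \<le> card L * (\<Sum>k\<in>L. (cmod (f (g \<otimes> k)))\<^sup>2)"
      using sum_squared_le_sum_of_squares by (simp add: mult.commute)
    finally show ?thesis .
  qed
  then have "(\<Sum>g\<in>carrier G. (cmod (\<Sum>k\<in>L. f (g \<otimes> k)))\<^sup>2)
      \<le> (\<Sum>g\<in>carrier G. card L * (\<Sum>k\<in>L. (cmod (f (g \<otimes> k)))\<^sup>2))"
    by (intro sum_mono)
  also have "\<dots> = card L * (\<Sum>k\<in>L. \<Sum>g\<in>carrier G. (cmod (f (g \<otimes> k)))\<^sup>2)"
    by (simp add: sum_distrib_left[symmetric] sum.swap[of _ L])
  also have "(\<Sum>k\<in>L. \<Sum>g\<in>carrier G. (cmod (f (g \<otimes> k)))\<^sup>2) = (\<Sum>k\<in>L. \<Sum>g\<in>carrier G. (cmod (f g))\<^sup>2)"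
    using LG by (intro sum.cong refl sum_translate_right)
  finally show ?thesis by (simp add: power2_eq_square)
qed

text \<open>Pulling functions on cosets back to the group multiplies the weighted squared norm by
  \<open>card (K \<inter> L)\<close>. The degree weights make this factor the same for both sides of
  the graph, so it cancels.\<close>

lemma norm_M0_le_iff:
  assumes fin: "finite (carrier G)" and K: "subgroup K G" and L: "subgroup L G" and eps: "0 \<le> \<epsilon>"
  shows "norm_M0 (lcosets K) (lcosets L) \<le> \<epsilon> \<longleftrightarrow> averaging_bound K L \<epsilon>"
proof -
  have LG: "k \<in> carrier G" if "k \<in> L" for k using subgroup.mem_carrier[OF L that] .
  have finK: "finite K" using fin K by (meson finite_subset subgroup.subset)
  have finL: "finite L" using fin LG by (meson finite_subset subsetI)
  have cardL: "0 < card L" using finL L subgroup.one_closed by (metis card_gt_0_iff empty_iff)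
  define d where "d = card (K \<inter> L)"
  have d: "0 < d"
    using finK subgroup.one_closed[OF K] subgroup.one_closed[OF L] by (auto simp: d_def card_gt_0_iff)
  define d0 where "d0 = side_degree (lcosets K) (lcosets L)"
  define d1 where "d1 = side_degree (lcosets L) (lcosets K)"
  have d1: "d * d1 = card L" using card_Int_side_degree[OF fin K L] by (simp add: d_def d1_def)
  have d0: "d * d0 = card K"
    using card_Int_side_degree[OF fin L K] by (simp add: d_def d0_def Int_commute)
  let ?V0 = "lcosets K" and ?V1 = "lcosets L"
  let ?H0 = "l2 ?V0 d0" and ?H1 = "l2 ?V1 d1"

  have l2_norm: "hnorm (l2 V n) \<phi> = sqrt (n * (\<Sum>v\<in>V. (cmod (\<phi> v))\<^sup>2))"
    for V :: "'a set set" and n \<phi>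
    unfolding hnorm_def l2_def by (simp add: complex_norm_square[symmetric] flip: of_real_sum)
  have norm0: "(\<Sum>g\<in>carrier G. (cmod (\<phi> (g <# K)))\<^sup>2) = d * (hnorm ?H0 \<phi>)\<^sup>2" for \<phi>
    using sum_over_lcosets[OF fin K, of "\<lambda>u. (cmod (\<phi> u))\<^sup>2"] d0
    by (simp add: l2_norm sum_nonneg flip: mult.assoc of_nat_mult)
  have norm1: "(\<Sum>g\<in>carrier G. (cmod (\<phi> (g <# L)))\<^sup>2) = d * (hnorm ?H1 \<phi>)\<^sup>2" for \<phi>
    using sum_over_lcosets[OF fin L, of "\<lambda>u. (cmod (\<phi> u))\<^sup>2"] d1
    by (simp add: l2_norm sum_nonneg flip: mult.assoc of_nat_mult)
  \<comment> \<open>Summing over \<open>L\<close> gives \<open>d\<close> times the neighbour sum,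
    that is \<open>d * d1\<close> times \<open>M0\<close>, and \<open>d * d1\<close> is
    \<open>card L\<close>.\<close>
  have M0: "(\<Sum>k\<in>L. \<phi> ((g \<otimes> k) <# K)) = card L * M0 ?V0 ?V1 \<phi> (g <# L)" if "g \<in> carrier G" for g \<phi>
  proof -
    have "0 < d1" using d1 cardL by (metis mult_0_right gr0I less_numeral_extra(3))
    moreover have "g <# L \<in> ?V1" using that by (auto simp: LCOSETS_def)
    ultimately show ?thesis
      using sum_over_coset[OF fin K L that, of \<phi>] d1
      by (auto simp: M0_def d_def[symmetric] d1_def[symmetric] field_simps simp flip: d1)
  qed
  have normM: "(\<Sum>g\<in>carrier G. (cmod (\<Sum>k\<in>L. \<phi> ((g \<otimes> k) <# K)))\<^sup>2)
      = d * (card L * hnorm ?H1 (M0 ?V0 ?V1 \<phi>))\<^sup>2" for \<phi>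
  proof -
    have "(\<Sum>g\<in>carrier G. (cmod (\<Sum>k\<in>L. \<phi> ((g \<otimes> k) <# K)))\<^sup>2)
        = (\<Sum>g\<in>carrier G. (card L)\<^sup>2 * (cmod (M0 ?V0 ?V1 \<phi> (g <# L)))\<^sup>2)"
      by (intro sum.cong refl) (simp add: M0 norm_mult power_mult_distrib)
    then show ?thesis
      by (simp add: norm1 sum_distrib_left[symmetric] power_mult_distrib mult_ac)
  qed
  have nonneg: "0 \<le> hnorm ?H0 \<phi>" "0 \<le> hnorm ?H1 \<psi>" for \<phi> \<psi>
    by (simp_all add: l2_norm sum_nonneg)
  \<comment> \<open>Stated for every \<open>c\<close> because it is used with
    \<open>\<epsilon>\<close> and also with 1, where it turns the contraction estimate into an
    admissible constant.\<close>
  have bound_iff: "(\<Sum>g\<in>carrier G. (cmod (\<Sum>k\<in>L. \<phi> ((g \<otimes> k) <# K)))\<^sup>2)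
        \<le> (c * real (card L))\<^sup>2 * (\<Sum>g\<in>carrier G. (cmod (\<phi> (g <# K)))\<^sup>2)
      \<longleftrightarrow> hnorm ?H1 (M0 ?V0 ?V1 \<phi>) \<le> c * hnorm ?H0 \<phi>" if c: "0 \<le> c" for c :: real and \<phi>
  proof -
    have "d * (card L * hnorm ?H1 (M0 ?V0 ?V1 \<phi>))\<^sup>2 \<le> (c * card L)\<^sup>2 * (d * (hnorm ?H0 \<phi>)\<^sup>2)
      \<longleftrightarrow> (d * (card L)\<^sup>2) * (hnorm ?H1 (M0 ?V0 ?V1 \<phi>))\<^sup>2 \<le> (d * (card L)\<^sup>2) * (c * hnorm ?H0 \<phi>)\<^sup>2"
      by (simp add: power_mult_distrib mult_ac)
    also have "\<dots> \<longleftrightarrow> (hnorm ?H1 (M0 ?V0 ?V1 \<phi>))\<^sup>2 \<le> (c * hnorm ?H0 \<phi>)\<^sup>2"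
      using d cardL by simp
    also have "\<dots> \<longleftrightarrow> hnorm ?H1 (M0 ?V0 ?V1 \<phi>) \<le> c * hnorm ?H0 \<phi>"
      using c nonneg by (intro power_mono_iff) auto
    finally show ?thesis by (simp only: normM norm0)
  qed
  have sum0: "(\<Sum>v\<in>?V0. \<phi> v) = 0 \<longleftrightarrow> (\<Sum>g\<in>carrier G. \<phi> (g <# K)) = 0" for \<phi> :: "'a set \<Rightarrow> complex"
    using sum_over_lcosets[OF fin K, of \<phi>] finK subgroup.one_closed[OF K] by auto

  have "norm_M0 ?V0 ?V1 \<le> \<epsilon> \<longleftrightarrow> (\<forall>\<phi>\<in>l2_0 ?V0 d0. hnorm ?H1 (M0 ?V0 ?V1 \<phi>) \<le> \<epsilon> * hnorm ?H0 \<phi>)"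
    unfolding norm_M0_def op_norm_on_def d0_def[symmetric] d1_def[symmetric]
  proof (rule Inf_bound_le_iff[where C = 1])
    fix \<phi>
    show "hnorm ?H1 (M0 ?V0 ?V1 \<phi>) \<le> 1 * hnorm ?H0 \<phi>"
      using averaging_contraction[OF fin L, of "\<lambda>g. \<phi> (g <# K)"] bound_iff[of 1 \<phi>] by simp
  qed (use eps nonneg in auto)
  also have "\<dots> \<longleftrightarrow> averaging_bound K L \<epsilon>"
  proof
    assume *: "\<forall>\<phi>\<in>l2_0 ?V0 d0. hnorm ?H1 (M0 ?V0 ?V1 \<phi>) \<le> \<epsilon> * hnorm ?H0 \<phi>"
    show "averaging_bound K L \<epsilon>"
      unfolding averaging_bound_def
    proof (intro allI impI)
      fix f :: "'a \<Rightarrow> complex"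
      assume f: "\<forall>g\<in>carrier G. \<forall>k\<in>K. f (g \<otimes> k) = f g" "(\<Sum>g\<in>carrier G. f g) = 0"
      obtain \<phi> where \<phi>: "\<phi> \<in> extensional ?V0" "\<And>g. g \<in> carrier G \<Longrightarrow> \<phi> (g <# K) = f g"
        using lcosets_function_lift[OF K, of f] f by blast
      have "\<phi> \<in> l2_0 ?V0 d0" using \<phi> f by (simp add: l2_0_def l2_def sum0)
      then show "(\<Sum>g\<in>carrier G. (cmod (\<Sum>k\<in>L. f (g \<otimes> k)))\<^sup>2)
        \<le> (\<epsilon> * card L)\<^sup>2 * (\<Sum>g\<in>carrier G. (cmod (f g))\<^sup>2)"
        using * bound_iff[OF eps, of \<phi>] \<phi>(2) LG by simp
    qed
  next
    assume *: "averaging_bound K L \<epsilon>"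
    show "\<forall>\<phi>\<in>l2_0 ?V0 d0. hnorm ?H1 (M0 ?V0 ?V1 \<phi>) \<le> \<epsilon> * hnorm ?H0 \<phi>"
    proof
      fix \<phi> assume \<phi>: "\<phi> \<in> l2_0 ?V0 d0"
      \<comment> \<open>The pullback of \<open>\<phi>\<close> to the group is right
        \<open>K\<close>-invariant, as \<open>averaging_bound\<close> demands.\<close>
      have "(g \<otimes> k) <# K = g <# K" if "g \<in> carrier G" "k \<in> K" for g k
        using that subgroup.mem_carrier[OF K] subgroup.m_inv_closed[OF K]
        by (simp add: lcos_eq_iff[OF K] inv_mult_group m_assoc)
      then show "hnorm ?H1 (M0 ?V0 ?V1 \<phi>) \<le> \<epsilon> * hnorm ?H0 \<phi>"
        using *[unfolded averaging_bound_def, rule_format, of "\<lambda>g. \<phi> (g <# K)"]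
          \<phi> sum0[of \<phi>] bound_iff[OF eps, of \<phi>] by (simp add: l2_0_def)
    qed
  qed
  finally show ?thesis .
qed

end


section \<open>The regular representation inside a given universe\<close>

text \<open>Each further coordinate is absorbed by an injection of the square of the infinite type
  \<open>'c\<close> into \<open>'c\<close>. This serves to code a function on the group as a single
  element.\<close>

lemma extensional_injection:
  assumes inf: "infinite (UNIV :: 'c set)" and "finite A"
  shows "\<exists>J :: ('a \<Rightarrow> 'c) \<Rightarrow> 'c. inj_on J (extensional A)"
  using \<open>finite A\<close>
proof induction
  case empty
  show ?case by (auto simp: extensional_empty)
next
  case (insert a A)
  then obtain J :: "('a \<Rightarrow> 'c) \<Rightarrow> 'c" where J: "inj_on J (extensional A)" by blast
  obtain p :: "'c \<times> 'c \<Rightarrow> 'c" where p: "inj p"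
    using card_of_Times_same_infinite[OF inf] unfolding card_of_ordIso[symmetric] bij_betw_def by auto
  have "inj_on (\<lambda>f. p (f a, J (restrict f A))) (extensional (insert a A))"
  proof (rule inj_onI)
    fix f f' assume f: "f \<in> extensional (insert a A)" "f' \<in> extensional (insert a A)"
      and "p (f a, J (restrict f A)) = p (f' a, J (restrict f' A))"
    then have a: "f a = f' a" and "J (restrict f A) = J (restrict f' A)"
      using injD[OF p] by auto
    then have "restrict f A = restrict f' A" using inj_onD[OF J] by simp
    then have "f x = f' x" if "x \<in> insert a A" for x
      using a that by (metis insertE restrict_apply')
    then show "f = f'" by (rule extensionalityI[OF f])
  qed
  then show ?case by blast
qed

text \<open>The functions on \<open>A\<close> carried over to the universe \<open>'u\<close> along an injection \<open>J\<close>.\<close>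

definition coded_l2 :: "(('a \<Rightarrow> complex) \<Rightarrow> 'u) \<Rightarrow> 'a set \<Rightarrow> 'u chilbert" where
  "coded_l2 J A =
     (let D = the_inv_into (extensional A) J in
     \<lparr>carrier = J ` extensional A, monoid.mult = undefined, one = undefined,
      zero = J (\<lambda>g\<in>A. 0), add = (\<lambda>x y. J (\<lambda>g\<in>A. D x g + D y g)),
      smult = (\<lambda>a x. J (\<lambda>g\<in>A. a * D x g)),
      cinner = (\<lambda>x y. \<Sum>g\<in>A. D x g * cnj (D y g))\<rparr>)"

locale coded_functions =
  fixes J :: "('a \<Rightarrow> complex) \<Rightarrow> 'u" and A :: "'a set"
  assumes inj: "inj_on J (extensional A)" and finite: "finite A"
begin

abbreviation "D \<equiv> the_inv_into (extensional A) J"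
abbreviation "H \<equiv> coded_l2 J A"

lemma decode [simp]: "f \<in> extensional A \<Longrightarrow> D (J f) = f"
  by (rule the_inv_into_f_f[OF inj])

lemma sel [simp]:
  "carrier H = J ` extensional A"
  "zero H = J (\<lambda>g\<in>A. 0)"
  "add H = (\<lambda>x y. J (\<lambda>g\<in>A. D x g + D y g))"
  "smult H = (\<lambda>a x. J (\<lambda>g\<in>A. a * D x g))"
  "cinner H = (\<lambda>x y. \<Sum>g\<in>A. D x g * cnj (D y g))"
  by (simp_all add: coded_l2_def Let_def)

lemma code_eqI:
  "\<lbrakk>f \<in> extensional A; h \<in> extensional A; \<And>g. g \<in> A \<Longrightarrow> f g = h g\<rbrakk> \<Longrightarrow> J f = J h"
  by (intro arg_cong[where f = J] extensionalityI)

lemma abelian_group_coded: "abelian_group H"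
proof (rule abelian_groupI)
  fix x assume "x \<in> carrier H"
  then obtain f where f: "f \<in> extensional A" "x = J f" by auto
  show "\<exists>y\<in>carrier H. y \<oplus>\<^bsub>H\<^esub> x = \<zero>\<^bsub>H\<^esub>"
    by (rule bexI[of _ "J (\<lambda>g\<in>A. - f g)"]) (use f in \<open>auto intro!: code_eqI\<close>)
qed (auto intro!: code_eqI simp: algebra_simps)

lemma hnorm_coded: "hnorm H x = sqrt (\<Sum>g\<in>A. (cmod (D x g))\<^sup>2)"
  by (simp add: hnorm_def complex_norm_square[symmetric] flip: of_real_sum)

lemma decode_minus:
  assumes "x \<in> carrier H" "y \<in> carrier H" "g \<in> A"
  shows "D (x \<ominus>\<^bsub>H\<^esub> y) g = D x g - D y g"
proof -
  interpret abelian_group H by (rule abelian_group_coded)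
  \<comment> \<open>Only addition has an explicit coordinate formula, so the coordinates of a
    difference are read off after adding \<open>y\<close> back.\<close>
  have "(x \<ominus>\<^bsub>H\<^esub> y) \<oplus>\<^bsub>H\<^esub> y = x"
    using assms(1,2) by (simp only: minus_eq a_assoc l_neg r_zero a_inv_closed)
  then have "D ((x \<ominus>\<^bsub>H\<^esub> y) \<oplus>\<^bsub>H\<^esub> y) g = D x g" by (rule arg_cong)
  then show ?thesis using assms(3) by (simp add: eq_diff_eq)
qed

lemma complex_hilbert_space_coded: "complex_hilbert_space H"
proof -
  interpret ab: abelian_group H by (rule abelian_group_coded)
  interpret module "ring_of_type_algebra :: complex ring" H
    by (rule moduleI[OF cring_from_type_algebra abelian_group_coded])
      (auto intro!: code_eqI simp: algebra_simps ring_of_type_algebra_def)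
  show ?thesis
  proof unfold_locales
    fix x y assume "x \<in> carrier H" "y \<in> carrier H"
    show "cinner H x y = cnj (cinner H y x)" by (simp add: mult.commute)
  next
    fix x assume x: "x \<in> carrier H" "x \<noteq> \<zero>\<^bsub>H\<^esub>"
    then obtain f where f: "f \<in> extensional A" "x = J f" by auto
    have "\<exists>g\<in>A. f g \<noteq> 0"
      using x f by (auto intro!: code_eqI)
    then have "0 < (\<Sum>g\<in>A. (cmod (f g))\<^sup>2)"
      using finite by (auto intro: sum_pos2)
    then show "0 < Re (cinner H x x)"
      using f by (simp add: complex_norm_square[symmetric] flip: of_real_sum)
  next
    fix xs :: "nat \<Rightarrow> 'u"
    assume xs: "\<And>n. xs n \<in> carrier H"
      and Cauchy: "\<And>e. 0 < e \<Longrightarrow> \<exists>N. \<forall>m\<ge>N. \<forall>n\<ge>N. hnorm H (xs m \<ominus>\<^bsub>H\<^esub> xs n) < e"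
    \<comment> \<open>Completeness is coordinatewise: each coordinate is bounded by the norm, hence
      Cauchy, and with finitely many coordinates the pointwise limit is a limit in norm.\<close>
    have le: "cmod (D (xs m) g - D (xs n) g) \<le> hnorm H (xs m \<ominus>\<^bsub>H\<^esub> xs n)" if "g \<in> A" for g m n
    proof -
      have "(cmod (D (xs m \<ominus>\<^bsub>H\<^esub> xs n) g))\<^sup>2 \<le> (\<Sum>g\<in>A. (cmod (D (xs m \<ominus>\<^bsub>H\<^esub> xs n) g))\<^sup>2)"
        using finite that by (intro member_le_sum) auto
      then show ?thesis
        using decode_minus[OF xs xs that] by (simp add: hnorm_coded real_le_rsqrt)
    qed
    have "\<exists>l. (\<lambda>n. D (xs n) g) \<longlonglongrightarrow> l" if g: "g \<in> A" for g
    proof -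
      have "Cauchy (\<lambda>n. D (xs n) g)"
        unfolding Cauchy_def dist_norm using Cauchy le[OF g] by (meson order_le_less_trans)
      then show ?thesis by (simp add: Cauchy_convergent_iff convergent_def)
    qed
    then obtain l where l: "\<And>g. g \<in> A \<Longrightarrow> (\<lambda>n. D (xs n) g) \<longlonglongrightarrow> l g" by metis
    define y where "y = J (restrict l A)"
    have y: "y \<in> carrier H" by (simp add: y_def)
    have "hnorm H (xs n \<ominus>\<^bsub>H\<^esub> y) = sqrt (\<Sum>g\<in>A. (cmod (D (xs n) g - l g))\<^sup>2)" for n
      unfolding hnorm_coded using decode_minus[OF xs y] by (simp add: y_def)
    moreover have "(\<lambda>n. sqrt (\<Sum>g\<in>A. (cmod (D (xs n) g - l g))\<^sup>2)) \<longlonglongrightarrow> sqrt (\<Sum>g\<in>A. (cmod (l g - l g))\<^sup>2)"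
      by (intro tendsto_intros l)
    ultimately show "\<exists>l\<in>carrier H. (\<lambda>n. hnorm H (xs n \<ominus>\<^bsub>H\<^esub> l)) \<longlonglongrightarrow> 0"
      using y by (intro bexI[of _ y]) auto
  qed (auto simp: algebra_simps sum.distrib sum_distrib_left)
qed

end


locale coded_regular = group G + coded_functions J "carrier G"
  for G :: "('a, 'b) monoid_scheme" (structure) and J :: "('a \<Rightarrow> complex) \<Rightarrow> 'u"
begin

text \<open>The right regular representation, conjugated by the coding. Restriction to the carrier
  makes it an element of \<open>Bij (carrier H)\<close>.\<close>

definition translate :: "'a \<Rightarrow> 'u \<Rightarrow> 'u" where
  "translate g = (\<lambda>x\<in>carrier H. J (\<lambda>h\<in>carrier G. D x (h \<otimes> g)))"

lemma translate_code [simp]: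
  "f \<in> extensional (carrier G) \<Longrightarrow> translate g (J f) = J (\<lambda>h\<in>carrier G. f (h \<otimes> g))"
  by (simp add: translate_def)

lemma unitary_rep_translate: "unitary_rep G H translate"
proof -
  have bij: "translate g \<in> Bij (carrier H)" if g: "g \<in> carrier G" for g
  proof -
    have "bij_betw (translate g) (carrier H) (carrier H)"
      by (rule bij_betw_byWitness[where f' = "translate (inv g)"])
        (use g in \<open>auto intro!: code_eqI simp: m_assoc\<close>)
    then show ?thesis by (simp add: Bij_def translate_def)
  qed
  have "group_action G (carrier H) translate"
    unfolding group_action_def
  proof (rule group_hom.intro[OF is_group group_BijGroup], unfold_locales)
    show "translate \<in> hom G (BijGroup (carrier H))"
    proof (rule homI)
      fix g assume "g \<in> carrier G"
      then show "translate g \<in> carrier (BijGroup (carrier H))" using bij by (simp add: BijGroup_def)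
    next
      fix g h assume gh: "g \<in> carrier G" "h \<in> carrier G"
      have "translate (g \<otimes> h) = compose (carrier H) (translate g) (translate h)"
      proof
        fix x show "translate (g \<otimes> h) x = compose (carrier H) (translate g) (translate h) x"
        proof (cases "x \<in> carrier H")
          case True
          then show ?thesis using gh by (auto intro!: code_eqI simp: compose_eq m_assoc)
        next
          case False
          \<comment> \<open>Outside the carrier both sides are \<open>undefined\<close>.\<close>
          then show ?thesis by (simp only: translate_def compose_def restrict_apply if_False)
        qed
      qed
      then show "translate (g \<otimes> h) = translate g \<otimes>\<^bsub>BijGroup (carrier H)\<^esub> translate h"
        using bij gh by (simp add: BijGroup_def)
    qed
  qed
  moreover have "cinner H (translate g x) (translate g y) = cinner H x y"
    if "g \<in> carrier G" "x \<in> carrier H" "y \<in> carrier H" for g x y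
    using that sum_translate_right[OF that(1), of "\<lambda>h. D x h * cnj (D y h)"] by auto
  ultimately show ?thesis
    unfolding unitary_rep_def
    by (auto simp del: sel(5) intro!: complex_hilbert_space_coded code_eqI)
qed

lemma invariant_iff:
  assumes f: "f \<in> extensional (carrier G)" and K: "K \<subseteq> carrier G"
  shows "J f \<in> invariant_vectors H translate K \<longleftrightarrow> (\<forall>k\<in>K. \<forall>g\<in>carrier G. f (g \<otimes> k) = f g)"
proof -
  have "translate k (J f) = J f \<longleftrightarrow> (\<forall>g\<in>carrier G. f (g \<otimes> k) = f g)" for k
  proof -
    have "translate k (J f) = J f \<longleftrightarrow> (\<lambda>g\<in>carrier G. f (g \<otimes> k)) = f"
      using f inj by (simp add: inj_on_eq_iff)
    also have "\<dots> \<longleftrightarrow> (\<forall>g\<in>carrier G. f (g \<otimes> k) = f g)"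
      using extensionalityI[OF restrict_extensional f, of "\<lambda>g. f (g \<otimes> k)"]
      by (auto, metis restrict_apply')
    finally show ?thesis .
  qed
  then show ?thesis using f by (simp add: invariant_vectors_def)
qed

text \<open>The sum \<open>y\<close> of the translates of \<open>x\<close> over \<open>L\<close> is
  \<open>card L\<close> times a projection of \<open>x\<close>, so \<open>cinner H y y\<close>
  equals \<open>card L * cinner H x y\<close>. The angle bound for this pair, divided by the norm of
  \<open>y\<close>, is the averaging bound.\<close>

lemma theta_le_imp_averaging_bound:
  assumes K: "subgroup K G" and L: "subgroup L G"
    and gen: "generate G (K \<union> L) = carrier G" and eps: "0 \<le> \<epsilon>"
    and theta: "theta H (invariant_vectors H translate K) (invariant_vectors H translate L) \<le> \<epsilon>"
  shows "averaging_bound K L \<epsilon>"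
  unfolding averaging_bound_def
proof (intro allI impI)
  fix f :: "'a \<Rightarrow> complex"
  assume f: "\<forall>g\<in>carrier G. \<forall>k\<in>K. f (g \<otimes> k) = f g" and f0: "(\<Sum>g\<in>carrier G. f g) = 0"
  interpret HS: complex_hilbert_space H by (rule complex_hilbert_space_coded)
  have KG: "K \<subseteq> carrier G" and LG: "L \<subseteq> carrier G" using K L by (simp_all add: subgroup.subset)
  let ?A = "invariant_vectors H translate K" and ?B = "invariant_vectors H translate L"
  define F where "F g = (\<Sum>k\<in>L. f (g \<otimes> k))" for g
  have F_inv: "F (g \<otimes> l) = F g" if "g \<in> carrier G" "l \<in> L" for g l
    unfolding F_def
    by (rule sum.reindex_bij_witness[where i = "\<lambda>k. inv l \<otimes> k" and j = "\<lambda>k. l \<otimes> k"])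
      (use that LG subgroup.m_closed[OF L] subgroup.m_inv_closed[OF L] in \<open>auto simp: m_assoc[symmetric] subset_eq\<close>)
  \<comment> \<open>Averaging is self-adjoint: translating by \<open>k\<close> moves it onto
    \<open>h\<close>, which is invariant. Used with \<open>h\<close> constant and with
    \<open>h\<close> the conjugate of \<open>F\<close>.\<close>
  have F_sum: "(\<Sum>g\<in>carrier G. F g * h g) = card L * (\<Sum>g\<in>carrier G. f g * h g)"
    if h: "\<And>g k. g \<in> carrier G \<Longrightarrow> k \<in> L \<Longrightarrow> h (g \<otimes> k) = h g" for h
  proof -
    have "(\<Sum>g\<in>carrier G. F g * h g) = (\<Sum>k\<in>L. \<Sum>g\<in>carrier G. f (g \<otimes> k) * h (g \<otimes> k))"
      unfolding F_def sum_distrib_right by (subst sum.swap) (simp add: h)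
    also have "\<dots> = (\<Sum>k\<in>L. \<Sum>g\<in>carrier G. f g * h g)"
      using LG by (intro sum.cong refl sum_translate_right) auto
    finally show ?thesis by simp
  qed
  define x where "x = J (restrict f (carrier G))"
  define y where "y = J (restrict F (carrier G))"
  have xH: "x \<in> carrier H" and yH: "y \<in> carrier H" by (simp_all add: x_def y_def)
  have x: "x \<in> ?A" and y: "y \<in> ?B"
    unfolding x_def y_def using KG LG f F_inv by (auto simp: invariant_iff subset_eq)
  \<comment> \<open>The right periods of the function coded by \<open>z\<close> form a subgroup
    containing \<open>K\<close> and \<open>L\<close>, hence the whole group by generation; so common
    invariant vectors are constant functions.\<close>
  have const: "D z g = D z \<one>" if z: "z \<in> ?A \<inter> ?B" and g: "g \<in> carrier G" for z g
  proof -
    have "z \<in> carrier H" using z by (simp add: invariant_vectors_def)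
    then obtain h where h: "h \<in> extensional (carrier G)" "z = J h" by auto
    let ?S = "{k \<in> carrier G. \<forall>g\<in>carrier G. h (g \<otimes> k) = h g}"
    have "subgroup ?S G"
    proof (rule subgroupI)
      show "?S \<noteq> {}" using one_closed by force
      fix k l assume k: "k \<in> ?S" and l: "l \<in> ?S"
      show "k \<otimes> l \<in> ?S" using k l by (auto simp: m_assoc[symmetric])
      \<comment> \<open>Periodicity under \<open>k\<close>, read at the point
        \<open>g \<otimes> inv k\<close>.\<close>
      have "h (g \<otimes> inv k) = h g" if "g \<in> carrier G" for g
        using k that bspec[of "carrier G" "\<lambda>g. h (g \<otimes> k) = h g" "g \<otimes> inv k"] by (auto simp: m_assoc)
      then show "inv k \<in> ?S" using k by simp
    qed auto
    moreover have "K \<union> L \<subseteq> ?S"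
      using z h KG LG by (auto simp: invariant_iff)
    ultimately have "carrier G \<subseteq> ?S" using gen generate_subgroup_incl[of "K \<union> L" ?S] by simp
    then have "h (\<one> \<otimes> g) = h \<one>" using g by blast
    then show ?thesis using h g by simp
  qed
  \<comment> \<open>Against a constant, \<open>x\<close> yields a multiple of the sum of
    \<open>f\<close> and \<open>y\<close> a multiple of the sum of \<open>F\<close>, which is
    \<open>card L\<close> times the former; both vanish.\<close>
  have "cinner H x z = 0 \<and> cinner H y z = 0" if z: "z \<in> ?A \<inter> ?B" for z
  proof -
    obtain c where "\<And>g. g \<in> carrier G \<Longrightarrow> D z g = c" using const[OF z] by blast
    then show ?thesis
      using f0 F_sum[of "\<lambda>_. 1"] by (simp add: x_def y_def sum_distrib_right[symmetric])
  qed
  then have "x \<in> orth_compl H (?A \<inter> ?B)" "y \<in> orth_compl H (?A \<inter> ?B)"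
    using xH yH by (simp_all add: orth_compl_def)
  then have "cmod (cinner H x y) \<le> \<epsilon> * hnorm H x * hnorm H y"
    using theta x y eps by (subst (asm) HS.theta_le_iff) (auto simp: invariant_vectors_def)
  moreover have "cinner H y y = card L * cinner H x y"
    using F_sum[of "\<lambda>g. cnj (F g)"] F_inv by (simp add: x_def y_def)
  then have "(hnorm H y)\<^sup>2 = card L * cmod (cinner H x y)"
    using HS.cinner_self[OF yH] by (metis norm_mult norm_of_nat norm_of_real abs_of_nonneg zero_le_power2)
  ultimately have "hnorm H y * hnorm H y \<le> (\<epsilon> * card L * hnorm H x) * hnorm H y"
    by (smt (verit, best) mult.assoc mult.commute mult_left_mono of_nat_0_le_iff power2_eq_square)
  \<comment> \<open>Cancels the norm of \<open>y\<close>; if that norm is 0, the claim is the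
    nonnegativity of the right-hand side.\<close>
  then have "hnorm H y \<le> \<epsilon> * card L * hnorm H x"
    using HS.hnorm_nonneg[OF yH] HS.hnorm_nonneg[OF xH] eps
    by (metis mult_le_cancel_right mult_nonneg_nonneg of_nat_0_le_iff order.strict_iff_order)
  then have "(hnorm H y)\<^sup>2 \<le> (\<epsilon> * card L)\<^sup>2 * (hnorm H x)\<^sup>2"
    using HS.hnorm_nonneg[OF yH] by (metis power_mono power_mult_distrib)
  then show "(\<Sum>g\<in>carrier G. (cmod (\<Sum>k\<in>L. f (g \<otimes> k)))\<^sup>2)
      \<le> (\<epsilon> * card L)\<^sup>2 * (\<Sum>g\<in>carrier G. (cmod (f g))\<^sup>2)"
    by (simp add: hnorm_coded x_def y_def F_def sum_nonneg)
qed

end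

section \<open>Equivalence of the norm bound and \<epsilon>-orthogonality\<close>

theorem theoremB12:
  fixes G :: "('a, 'b) monoid_scheme" (structure)
    and K0 K1 :: "'a set"
    and \<epsilon> :: real
  assumes "group G"
    and "finite (carrier G)"
    and "subgroup K0 G"
    and "subgroup K1 G"
    and "generate G (K0 \<union> K1) = carrier G"
    and "\<exists>f :: complex \<Rightarrow> 'u. inj f"
    and "0 \<le> \<epsilon>"
  shows "norm_M0 (lcosets K0) (lcosets K1) \<le> \<epsilon> \<longleftrightarrow> eps_orthogonal TYPE('u) G K0 K1 \<epsilon>"
proof -
  interpret group G by fact
  obtain e :: "complex \<Rightarrow> 'u" where e: "inj e" using assms(6) by blast
  \<comment> \<open>As \<open>complex\<close> is infinite, functions on the finite group can be
    coded by complex numbers; \<open>e\<close> then places the regular representation in the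
    universe \<open>'u\<close>.\<close>
  obtain J :: "('a \<Rightarrow> complex) \<Rightarrow> complex" where J: "inj_on J (extensional (carrier G))"
    using extensional_injection[OF infinite_UNIV_char_0 assms(2)] by blast
  interpret coded_regular G "e \<circ> J"
    by unfold_locales (use assms(2) e J in \<open>auto intro: comp_inj_on inj_on_subset\<close>)
  have "norm_M0 (lcosets K0) (lcosets K1) \<le> \<epsilon> \<longleftrightarrow> averaging_bound K0 K1 \<epsilon>"
    using assms by (intro norm_M0_le_iff)
  \<comment> \<open>From left to right every representation is treated; the converse instantiates
    the regular one.\<close>
  also have "\<dots> \<longleftrightarrow> eps_orthogonal TYPE('u) G K0 K1 \<epsilon>"
    using averaging_bound_imp_theta_le theta_le_imp_averaging_bound unitary_rep_translate assms
    unfolding eps_orthogonal_def by blast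
  finally show ?thesis .
qed

end
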